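(* Let $\nu>-1$ be real and let $m\ge 1$ be an integer. If $\mathcal{N}_{m,\nu}=\emptyset$, then the positive zeros of $J_\nu$ and of $R_{m-1,\nu+1}J_{\nu+m}$ are interlaced according to the pattern $$0<j_{\nu,1}<\omega_{m,\nu,1}<j_{\nu,2}<\omega_{m,\nu,2}<\cdots .$$
   Context: $J_\nu$ denotes the Bessel function of the first kind of order $\nu$, considered for $x>0$, and $\{j_{\nu,k}\}_{k=1}^\infty$ is the sequence of all its positive zeros in increasing order. For a nonnegative integer $n$ and real $\lambda>0$, the Lommel polynomial (a polynomial in $1/x$) is $$R_{n,\lambda}(x)=\sum_{k=0}^{\lfloor n/2\rfloor}(-1)^k\binom{n-k}{k}\frac{\Gamma(\lambda+n-k)}{\Gamma(\lambda+k)}\left(\frac{x}{2}\right)^{2k-n},\qquad x>0.$$ $\mathcal{N}_{m,\nu}=\{j_{\nu,k} : k\ge 1,\ J_{\nu+m}(j_{\nu,k})=0\}$ is the set of positive zeros common to $J_\nu$ and $J_{\nu+m}$. The sequence $\{\omega_{m,\nu,k}\}_{k=1}^\infty$ is the increasing enumeration of the set $\{x>0: J_{\nu+m}(x)=0\}\cup\{x>0: R_{m-1,\nu+1}(x)=0\}$ (a set union, each element listed once). *)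

theory Defs
  imports "HOL-Analysis.Analysis"
begin

text \<open>
  The power series of \<open>J\<^sub>\<nu>(x)\<close>; \<open>rGamma\<close> is the reciprocal Gamma function. Only \<open>x > 0\<close> is meaningful,
  since \<open>powr\<close> is the real power of a positive base.
\<close>
definition Bessel_J :: "real \<Rightarrow> real \<Rightarrow> real" where
  "Bessel_J \<nu> x =
     (\<Sum>k. (- 1) ^ k * rGamma (\<nu> + real k + 1) / fact k * (x / 2) powr (2 * real k + \<nu>))"

definition Lommel_R :: "nat \<Rightarrow> real \<Rightarrow> real \<Rightarrow> real" where
  "Lommel_R n \<mu> x =
     (\<Sum>k = 0..n div 2. (- 1) ^ k * real ((n - k) choose k)
        * (Gamma (\<mu> + real n - real k) / Gamma (\<mu> + real k))
        * (x / 2) powi (2 * int k - int n))"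

text \<open>
  \<open>kth_element S k\<close> is the \<open>k\<close>-th element (counting from \<open>k = 1\<close>) of a set \<open>S\<close> of order
  type \<open>\<omega>\<close>. If \<open>S\<close> has no increasing enumeration, the value is unspecified.
\<close>
definition kth_element :: "real set \<Rightarrow> nat \<Rightarrow> real" where
  "kth_element S k = (THE a :: nat \<Rightarrow> real. strict_mono a \<and> range a = S) (k - 1)"

lemma increasing_enumeration_unique:
  fixes a b :: "nat \<Rightarrow> real"
  assumes "strict_mono a" "strict_mono b" "range a = range b"
  shows "a = b"
proof
  fix n
  show "a n = b n"
  proof (induction n rule: less_induct)
    case (less n)
    obtain p where p: "a n = b p" using assms(3) by (metis rangeE rangeI)
    obtain q where q: "b n = a q" using assms(3) by (metis rangeE rangeI)
    have "\<not> p < n" using less p assms(1) by (metis nat_neq_iff strict_mono_eq)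
    moreover have "\<not> q < n" using less q assms(2) by (metis nat_neq_iff strict_mono_eq)
    ultimately have "b n \<le> b p" "a n \<le> a q"
      using assms(1,2) by (simp_all add: strict_mono_less_eq)
    then have "b n \<le> a n" "a n \<le> b n" using p q by simp_all
    then show ?case by simp
  qed
qed

lemma kth_element_eq:
  assumes "strict_mono a" "range a = S"
  shows "kth_element S k = a (k - 1)"
proof -
  have "(THE a :: nat \<Rightarrow> real. strict_mono a \<and> range a = S) = a"
    using assms by (intro the_equality) (auto intro: increasing_enumeration_unique)
  then show ?thesis by (simp add: kth_element_def)
qed

definition bessel_zero :: "real \<Rightarrow> nat \<Rightarrow> real" where
  "bessel_zero \<nu> = kth_element {x. x > 0 \<and> Bessel_J \<nu> x = 0}"

definition common_zeros :: "nat \<Rightarrow> real \<Rightarrow> real set" where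
  "common_zeros m \<nu> =
     {bessel_zero \<nu> k | k. k \<ge> 1 \<and> Bessel_J (\<nu> + real m) (bessel_zero \<nu> k) = 0}"

definition omega :: "nat \<Rightarrow> real \<Rightarrow> nat \<Rightarrow> real" where
  "omega m \<nu> =
     kth_element ({x. x > 0 \<and> Bessel_J (\<nu> + real m) x = 0}
                  \<union> {x. x > 0 \<and> Lommel_R (m - 1) (\<nu> + 1) x = 0})"

end

theory Submission
  imports Defs
begin

text \<open>
  Both \<open>L\<^sub>k = R\<^bsub>k-1,\<nu>+1\<^esub>\<close> (with \<open>L\<^sub>0 = 0\<close>) and \<open>J\<^bsub>\<nu>+k\<^esub>\<close> solve
  \<open>u\<^bsub>k+2\<^esub> = (2(\<nu>+k+1)/x) u\<^bsub>k+1\<^esub> - u\<^sub>k\<close>, with Casoratian \<open>J\<^sub>\<nu>\<close>. Hence \<open>F = L\<^sub>m J\<^bsub>\<nu>+m\<^esub> / J\<^sub>\<nu>\<close> is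
  a diagonal entry of the Green function of a half-line Jacobi operator, and it increases between its
  poles: \<open>J\<^sub>\<nu>\<^sup>2 F'\<close> is a sum of \<open>J\<^bsub>\<nu>+m\<^esub>\<^sup>2\<close> and \<open>L\<^sub>m\<^sup>2\<close> weighted by the
  Casoratians of each solution with its \<open>x\<close>-derivative, whose signs follow by telescoping in \<open>k\<close> from
  \<open>k = 0\<close> and \<open>k = \<infinity>\<close>. So \<open>L\<^sub>m J\<^bsub>\<nu>+m\<^esub>\<close> has at most one zero between consecutive zeros of \<open>J\<^sub>\<nu>\<close>, and
  none before the first since \<open>F > 0\<close> near \<open>0\<close>. At a zero of \<open>J\<^sub>\<nu>\<close> it equals
  \<open>L\<^sub>m\<^sup>2 J\<^bsub>\<nu>+1\<^esub> = - L\<^sub>m\<^sup>2 J\<^sub>\<nu>'\<close>, which alternates in sign.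
\<close>

section \<open>Power series of Bessel functions\<close>

text \<open>For x > 0, \<open>Bessel_J \<mu> x\<close> is (x/2)^\<mu> times this function at
  (x/2)^2. It is the Bessel-Clifford function at -t; splitting off the real power permits termwise
  differentiation and evaluation at 0.\<close>

definition bessel_E :: "real \<Rightarrow> real \<Rightarrow> real" where
  "bessel_E \<mu> t = (\<Sum>k. (- 1) ^ k * rGamma (\<mu> + real k + 1) / fact k * t ^ k)"

lemma rGamma_real_rec: "rGamma (z::real) = z * rGamma (z + 1)"
  by (simp add: rGamma_plus1)

lemma rGamma_real_pos: "z > 0 \<Longrightarrow> rGamma (z::real) > 0"
  by (simp add: rGamma_inverse_Gamma Gamma_real_pos)

text \<open>Ratio test: successive terms shrink by the factor s / (\<mu> + n + 1), at most 1/2 in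
  absolute value once n \<ge> |\<mu>| + 2|s|. The series dominates that of \<open>bessel_E\<close>,
  and its terms later bound \<open>Bessel_J\<close> as the order grows.\<close>

lemma summable_rGamma_power: "summable (\<lambda>k. norm (rGamma (\<mu> + real k + 1) * (s::real) ^ k))"
proof (rule summable_ratio_test[where c = "1/2" and N = "nat \<lceil>\<bar>\<mu>\<bar> + 2 * \<bar>s\<bar>\<rceil>"])
  fix n assume "nat \<lceil>\<bar>\<mu>\<bar> + 2 * \<bar>s\<bar>\<rceil> \<le> n"
  then have n: "real n \<ge> \<bar>\<mu>\<bar> + 2 * \<bar>s\<bar>" by linarith
  define z where "z = \<mu> + real n + 1"
  have z: "z \<ge> 2 * \<bar>s\<bar>" "z > 0" using n by (auto simp: z_def)
  have "\<bar>s\<bar> * \<bar>rGamma (z + 1)\<bar> \<le> (1/2) * (\<bar>z\<bar> * \<bar>rGamma (z + 1)\<bar>)"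
    using z mult_right_mono[of "\<bar>s\<bar>" "z / 2" "\<bar>rGamma (z + 1)\<bar>"] by simp
  also have "\<bar>z\<bar> * \<bar>rGamma (z + 1)\<bar> = \<bar>rGamma z\<bar>"
    using rGamma_real_rec[of z] by (simp add: abs_mult)
  finally have "(\<bar>s\<bar> * \<bar>rGamma (z + 1)\<bar>) * \<bar>s\<bar> ^ n \<le> (1/2 * \<bar>rGamma z\<bar>) * \<bar>s\<bar> ^ n"
    by (rule mult_right_mono) simp
  moreover have "\<mu> + real (Suc n) + 1 = z + 1" "\<mu> + real n + 1 = z" by (auto simp: z_def)
  ultimately show "norm (norm (rGamma (\<mu> + real (Suc n) + 1) * s ^ Suc n))
      \<le> 1 / 2 * norm (norm (rGamma (\<mu> + real n + 1) * s ^ n))"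
    by (simp only: norm_mult norm_power power_Suc real_norm_def abs_abs mult_ac abs_mult power_abs)
qed simp

lemma summable_bessel_E: "summable (\<lambda>k. (- 1) ^ k * rGamma (\<mu> + real k + 1) / fact k * (t::real) ^ k)"
proof (rule summable_comparison_test')
  show "summable (\<lambda>k. norm (rGamma (\<mu> + real k + 1) * t ^ k))" by (rule summable_rGamma_power)
  fix n :: nat
  have "(1::real) \<le> fact n" by simp
  then have "norm (rGamma (\<mu> + real n + 1) * t ^ n) / fact n \<le> norm (rGamma (\<mu> + real n + 1) * t ^ n) / 1"
    by (intro divide_left_mono) auto
  then show "norm ((- 1) ^ n * rGamma (\<mu> + real n + 1) / fact n * t ^ n)
      \<le> norm (rGamma (\<mu> + real n + 1) * t ^ n)"
    by (simp add: abs_mult power_abs)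
qed

text \<open>Termwise differentiation: the factor k + 1 cancels against the factorial, leaving the
  series of order \<mu> + 1 with the opposite sign.\<close>

lemma bessel_E_deriv: "(bessel_E \<mu> has_field_derivative - bessel_E (\<mu> + 1) t) (at t)"
proof -
  define c where "c = (\<lambda>k. (- 1) ^ k * rGamma (\<mu> + real k + 1) / fact k)"
  have 1: "((\<lambda>x. \<Sum>k. c k * x ^ k) has_field_derivative (\<Sum>k. diffs c k * t ^ k)) (at t)"
    by (rule termdiffs_strong_converges_everywhere) (unfold c_def, rule summable_bessel_E)
  have 2: "(\<lambda>x. \<Sum>k. c k * x ^ k) = bessel_E \<mu>"
    by (simp add: bessel_E_def c_def fun_eq_iff)
  have "diffs c k = - ((- 1) ^ k * rGamma ((\<mu> + 1) + real k + 1) / fact k)" for k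
  proof -
    define N where "N = real (Suc k)"
    have "N \<noteq> 0" "\<mu> + N + 1 = (\<mu> + 1) + real k + 1" by (simp_all add: N_def)
    moreover have "diffs c k = N * ((- 1) ^ Suc k * rGamma (\<mu> + N + 1) / (N * fact k))"
      unfolding diffs_def c_def fact_Suc N_def by (rule refl)
    ultimately show ?thesis by simp
  qed
  then have "(\<Sum>k. diffs c k * t ^ k) = (\<Sum>k. - ((- 1) ^ k * rGamma ((\<mu> + 1) + real k + 1) / fact k * t ^ k))"
    by simp
  also have "\<dots> = - bessel_E (\<mu> + 1) t"
    unfolding bessel_E_def by (rule suminf_minus) (rule summable_bessel_E)
  finally have "(\<Sum>k. diffs c k * t ^ k) = - bessel_E (\<mu> + 1) t" .
  then show ?thesis using 1 2 by simp
qed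

lemma bessel_E_0: "bessel_E \<mu> 0 = rGamma (\<mu> + 1)"
  unfolding bessel_E_def
  using powser_zero[of "\<lambda>k. (- 1) ^ k * rGamma (\<mu> + real k + 1) / fact k"] by simp

text \<open>Coefficientwise this is 1/Gamma(z) = z/Gamma(z + 1) with z = (\<mu> + 1) + k; the
  summand k cancels a factor of k! and yields the shifted series of order \<mu> + 2.\<close>

lemma bessel_E_rec: "bessel_E \<mu> t = (\<mu> + 1) * bessel_E (\<mu> + 1) t - t * bessel_E (\<mu> + 2) t"
proof -
  define f where "f = (\<lambda>\<mu> k. (- 1) ^ k * rGamma (\<mu> + real k + 1) / fact k * t ^ k)"
  have sm: "summable (f \<mu>)" for \<mu> unfolding f_def by (rule summable_bessel_E)
  have E: "bessel_E \<mu> t = suminf (f \<mu>)" for \<mu> by (simp add: bessel_E_def f_def)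
  \<comment> \<open>The series of \<open>t * bessel_E (\<mu> + 2) t\<close>, moved up one index so
    that powers of t align.\<close>
  define g where "g = (\<lambda>k. case k of 0 \<Rightarrow> 0 | Suc j \<Rightarrow> t * f (\<mu> + 2) j)"
  have "(\<lambda>j. t * f (\<mu> + 2) j) sums (t * bessel_E (\<mu> + 2) t)"
    unfolding E by (intro sums_mult summable_sums sm)
  then have "(\<lambda>j. g (Suc j)) sums (t * bessel_E (\<mu> + 2) t)" by (simp add: g_def)
  then have g: "g sums (t * bessel_E (\<mu> + 2) t)"
    by (subst (asm) sums_Suc_iff) (simp add: g_def)
  have "(\<lambda>k. (\<mu> + 1) * f (\<mu> + 1) k - g k) sums ((\<mu> + 1) * bessel_E (\<mu> + 1) t - t * bessel_E (\<mu> + 2) t)"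
    unfolding E[of "\<mu> + 1"] by (intro sums_diff g sums_mult summable_sums sm)
  moreover have "(\<mu> + 1) * f (\<mu> + 1) k - g k = f \<mu> k" for k
  proof (cases k)
    case 0
    then show ?thesis using rGamma_real_rec[of "\<mu> + 1"] by (simp add: f_def g_def add_ac)
  next
    case (Suc j)
    define z where "z = \<mu> + 1 + real (Suc j)"
    have z: "(\<mu> + 1) + real (Suc j) + 1 = z + 1" "(\<mu> + 2) + real j + 1 = z + 1"
      "\<mu> + real (Suc j) + 1 = z" by (auto simp: z_def)
    have "(\<mu> + 1) * f (\<mu> + 1) k - g k
        = ((\<mu> + 1) + real (Suc j)) * ((- 1) ^ Suc j * rGamma (z + 1) / fact (Suc j) * t ^ Suc j)"
      unfolding Suc g_def f_def nat.case z
      by (simp add: fact_Suc divide_simps) (simp add: algebra_simps)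
    also have "\<dots> = f \<mu> k"
      unfolding Suc f_def z using rGamma_real_rec[of z] by (simp add: z_def)
    finally show ?thesis .
  qed
  ultimately have "f \<mu> sums ((\<mu> + 1) * bessel_E (\<mu> + 1) t - t * bessel_E (\<mu> + 2) t)" by simp
  then show ?thesis unfolding E by (simp add: sums_iff)
qed

text \<open>Each step from k to k + 1 divides the reciprocal Gamma value by some z \<ge> 1, so the
  first value times the exponential series is a majorant.\<close>

lemma bessel_E_bound:
  assumes "\<mu> \<ge> 0" "t \<ge> 0"
  shows "\<bar>bessel_E \<mu> t\<bar> \<le> rGamma (\<mu> + 1) * exp t"
proof -
  have mono: "rGamma (\<mu> + real k + 1) \<le> rGamma (\<mu> + 1)" for k
  proof (induction k)
    case (Suc k)
    define z where "z = \<mu> + real k + 1"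
    have "z \<ge> 1" using assms by (simp add: z_def)
    then have "1 * rGamma (z + 1) \<le> z * rGamma (z + 1)"
      using rGamma_real_pos[of "z + 1"] by (intro mult_right_mono) auto
    then have "rGamma (z + 1) \<le> rGamma z" using rGamma_real_rec[of z] by simp
    with Suc show ?case by (simp add: z_def add_ac)
  qed simp
  have ex: "(\<lambda>n. rGamma (\<mu> + 1) * (t ^ n /\<^sub>R fact n)) sums (rGamma (\<mu> + 1) * exp t)"
    by (intro sums_mult exp_converges)
  have "norm (bessel_E \<mu> t) \<le> (\<Sum>n. rGamma (\<mu> + 1) * (t ^ n /\<^sub>R fact n))"
    unfolding bessel_E_def
  proof (rule norm_suminf_le)
    fix n
    have "rGamma (\<mu> + real n + 1) \<ge> 0"
      using rGamma_real_pos[of "\<mu> + real n + 1"] assms by simp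
    moreover have "rGamma (\<mu> + real n + 1) * (t ^ n / fact n) \<le> rGamma (\<mu> + 1) * (t ^ n / fact n)"
      using assms by (intro mult_right_mono mono) auto
    ultimately show "norm ((- 1) ^ n * rGamma (\<mu> + real n + 1) / fact n * t ^ n)
      \<le> rGamma (\<mu> + 1) * (t ^ n /\<^sub>R fact n)"
      using assms by (simp add: abs_mult power_abs field_simps)
  qed (use ex in \<open>auto simp: sums_iff\<close>)
  then show ?thesis using ex by (simp add: sums_iff)
qed

section \<open>Bessel functions of a positive argument\<close>

lemma Bessel_J_eq:
  assumes "x > 0"
  shows "Bessel_J \<mu> x = (x / 2) powr \<mu> * bessel_E \<mu> ((x / 2)\<^sup>2)"
proof -
  have "(x / 2) powr (2 * real k + \<mu>) = (x / 2) powr \<mu> * ((x / 2)\<^sup>2) ^ k" for k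
  proof -
    have "(x / 2) powr (2 * real k) = ((x / 2)\<^sup>2) ^ k"
      using assms powr_realpow[of "x / 2" "2 * k"] by (simp add: power_mult)
    then show ?thesis by (simp add: powr_add)
  qed
  then have "Bessel_J \<mu> x
      = (\<Sum>k. (x / 2) powr \<mu> * ((- 1) ^ k * rGamma (\<mu> + real k + 1) / fact k * ((x / 2)\<^sup>2) ^ k))"
    unfolding Bessel_J_def by (simp add: mult_ac)
  also have "\<dots> = (x / 2) powr \<mu> * bessel_E \<mu> ((x / 2)\<^sup>2)"
    unfolding bessel_E_def by (rule suminf_mult) (rule summable_bessel_E)
  finally show ?thesis .
qed

text \<open>The power contributes \<mu>/x; the inner derivative x/2 of (x/2)^2 raises the exponent
  to \<mu> + 1.\<close>

lemma Bessel_J_deriv: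
  assumes "x > 0"
  shows "(Bessel_J \<mu> has_field_derivative \<mu> / x * Bessel_J \<mu> x - Bessel_J (\<mu> + 1) x) (at x)"
proof -
  have "((\<lambda>x. (x / 2) powr \<mu> * bessel_E \<mu> ((x / 2)\<^sup>2)) has_field_derivative
      \<mu> * (x / 2) powr (\<mu> - 1) * (1 / 2) * bessel_E \<mu> ((x / 2)\<^sup>2)
      + (x / 2) powr \<mu> * (- bessel_E (\<mu> + 1) ((x / 2)\<^sup>2) * (x / 2))) (at x)"
    using assms
    by (auto intro!: derivative_eq_intros DERIV_chain2[OF bessel_E_deriv] simp: power2_eq_square)
  moreover have "\<mu> * (x / 2) powr (\<mu> - 1) * (1 / 2) * bessel_E \<mu> ((x / 2)\<^sup>2)
      + (x / 2) powr \<mu> * (- bessel_E (\<mu> + 1) ((x / 2)\<^sup>2) * (x / 2))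
      = \<mu> / x * Bessel_J \<mu> x - Bessel_J (\<mu> + 1) x"
    using assms by (simp add: Bessel_J_eq powr_diff powr_add mult_ac)
  ultimately have "((\<lambda>x. (x / 2) powr \<mu> * bessel_E \<mu> ((x / 2)\<^sup>2)) has_field_derivative
     \<mu> / x * Bessel_J \<mu> x - Bessel_J (\<mu> + 1) x) (at x)" by simp
  then show ?thesis
    by (rule has_field_derivative_transform_within_open[of _ _ _ "{0<..}"])
       (use assms in \<open>auto simp: Bessel_J_eq\<close>)
qed

lemma Bessel_J_rec:
  assumes "x > 0"
  shows "Bessel_J (\<mu> + 2) x = 2 * (\<mu> + 1) / x * Bessel_J (\<mu> + 1) x - Bessel_J \<mu> x"
proof -
  have "(x / 2) powr (\<mu> + 2) = (x / 2) powr \<mu> * (x / 2)\<^sup>2"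
    using assms powr_realpow[of "x / 2" 2] by (simp add: powr_add)
  moreover have "(x / 2) powr (\<mu> + 1) = (x / 2) powr \<mu> * (x / 2)"
    using assms by (simp add: powr_add)
  ultimately show ?thesis
    using assms unfolding Bessel_J_eq[OF assms] bessel_E_rec[of \<mu> "(x / 2)\<^sup>2"]
    by (simp only:) (simp add: power2_eq_square field_simps)
qed

lemma isCont_Bessel_J: "x > 0 \<Longrightarrow> isCont (Bessel_J \<mu>) x"
  by (rule DERIV_isCont) (rule Bessel_J_deriv)

text \<open>The sign is that of the \<open>bessel_E\<close> factor, whose limit 1/Gamma(\<mu> + 1)
  is positive for \<mu> > -1. The power itself may blow up at 0 when \<mu> < 0.\<close>

lemma Bessel_J_pos_near_0:
  assumes "\<mu> > - 1"
  shows "\<forall>\<^sub>F x in at_right 0. Bessel_J \<mu> x > 0"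
proof -
  have "isCont (\<lambda>x. bessel_E \<mu> ((x / 2)\<^sup>2)) 0"
    by (rule isCont_o2[OF _ DERIV_isCont[OF bessel_E_deriv]]) (intro continuous_intros, simp)
  then have "((\<lambda>x. bessel_E \<mu> ((x / 2)\<^sup>2)) \<longlongrightarrow> rGamma (\<mu> + 1)) (at_right 0)"
    by (simp add: isCont_def bessel_E_0 filterlim_at_split)
  then have "\<forall>\<^sub>F x in at_right 0. bessel_E \<mu> ((x / 2)\<^sup>2) > 0"
    using assms by (intro order_tendstoD(1)) (auto intro: rGamma_real_pos)
  moreover have "\<forall>\<^sub>F x::real in at_right 0. x > 0" by (simp add: eventually_at_right_less)
  ultimately show ?thesis
    by eventually_elim (simp add: Bessel_J_eq)
qed

text \<open>By \<open>bessel_E_bound\<close> the values are dominated by terms of a summable series.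
  This supplies the boundary value at k = \<infinity> for the telescoping in k.\<close>

lemma Bessel_J_order_tendsto_0:
  assumes "x > 0"
  shows "(\<lambda>k. Bessel_J (\<nu> + real k) x) \<longlonglongrightarrow> 0"
proof (rule Lim_null_comparison)
  define C where "C = (x / 2) powr \<nu> * exp ((x / 2)\<^sup>2)"
  have "(\<lambda>k. rGamma (\<nu> + real k + 1) * (x / 2) ^ k) \<longlonglongrightarrow> 0"
    by (rule summable_LIMSEQ_zero[OF summable_norm_cancel[OF summable_rGamma_power]])
  then show "(\<lambda>k. C * (rGamma (\<nu> + real k + 1) * (x / 2) ^ k)) \<longlonglongrightarrow> 0"
    by (rule tendsto_mult_right_zero)
  show "\<forall>\<^sub>F k in sequentially. norm (Bessel_J (\<nu> + real k) x)
      \<le> C * (rGamma (\<nu> + real k + 1) * (x / 2) ^ k)"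
    using eventually_ge_at_top[of "nat \<lceil>\<bar>\<nu>\<bar>\<rceil>"]
  proof eventually_elim
    case (elim k)
    then have "\<nu> + real k \<ge> 0" by linarith
    then have "\<bar>bessel_E (\<nu> + real k) ((x / 2)\<^sup>2)\<bar> \<le> rGamma (\<nu> + real k + 1) * exp ((x / 2)\<^sup>2)"
      by (intro bessel_E_bound) auto
    then have "(x / 2) powr (\<nu> + real k) * \<bar>bessel_E (\<nu> + real k) ((x / 2)\<^sup>2)\<bar>
        \<le> (x / 2) powr (\<nu> + real k) * (rGamma (\<nu> + real k + 1) * exp ((x / 2)\<^sup>2))"
      by (rule mult_left_mono) simp
    moreover have "(x / 2) powr (\<nu> + real k) = (x / 2) powr \<nu> * (x / 2) ^ k"
      using assms by (simp add: powr_add powr_realpow)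
    ultimately show ?case
      using assms by (simp add: Bessel_J_eq abs_mult C_def mult_ac)
  qed
qed

text \<open>By the mean value theorem \<open>bessel_E \<mu>\<close> drops on [0, t] by at most
  \<open>t * rGamma (\<mu> + 2) * exp t\<close>, while it starts at
  \<open>(\<mu> + 1) * rGamma (\<mu> + 2)\<close>. Hence \<mu> + 1 > t exp t suffices.\<close>

lemma Bessel_J_large_order_pos:
  assumes "x > 0"
  shows "\<exists>k. Bessel_J (\<nu> + real k) x > 0"
proof -
  define t where "t = (x / 2)\<^sup>2"
  have t: "t > 0" using assms by (simp add: t_def)
  obtain k :: nat where k: "real k > \<bar>\<nu>\<bar> + t * exp t" using reals_Archimedean2 by blast
  define \<mu> where "\<mu> = \<nu> + real k"
  have "t * exp t > 0" using t by simp
  then have \<mu>: "\<mu> > 0" "t * exp t < \<mu> + 1" using k by (auto simp: \<mu>_def)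
  obtain z where z: "0 < z" "z < t" "bessel_E \<mu> t - bessel_E \<mu> 0 = (t - 0) * - bessel_E (\<mu> + 1) z"
    using MVT2[OF t, of "bessel_E \<mu>" "\<lambda>z. - bessel_E (\<mu> + 1) z"] bessel_E_deriv by blast
  have r: "rGamma (\<mu> + 2) > 0" using \<mu> by (intro rGamma_real_pos) auto
  have "bessel_E (\<mu> + 1) z \<le> rGamma (\<mu> + 2) * exp z"
    using bessel_E_bound[of "\<mu> + 1" z] \<mu> z by (simp add: add_ac abs_le_iff)
  also have "\<dots> \<le> rGamma (\<mu> + 2) * exp t" using r z by (intro mult_left_mono) auto
  finally have "t * bessel_E (\<mu> + 1) z \<le> t * (rGamma (\<mu> + 2) * exp t)"
    using t by (intro mult_left_mono) auto
  also have "\<dots> < rGamma (\<mu> + 2) * (\<mu> + 1)"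
    using mult_strict_left_mono[OF \<mu>(2) r] by (simp add: mult_ac)
  also have "\<dots> = bessel_E \<mu> 0"
    using rGamma_real_rec[of "\<mu> + 1"] by (simp add: bessel_E_0 add_ac mult.commute)
  finally have "bessel_E \<mu> t > 0" using z(3) by simp
  then show ?thesis
    using assms by (intro exI[of _ k]) (simp add: Bessel_J_eq \<mu>_def t_def)
qed

section \<open>Recurrence in the order and simplicity of the zeros\<close>

lemma Bessel_J_order_rec:
  assumes "x > 0"
  shows "Bessel_J (\<nu> + real (k + 2)) x
    = 2 * (\<nu> + real k + 1) / x * Bessel_J (\<nu> + real (k + 1)) x - Bessel_J (\<nu> + real k) x"
  using Bessel_J_rec[OF assms, of "\<nu> + real k"] by (simp add: algebra_simps)

text \<open>Two consecutive vanishing orders would make all higher orders vanish by the recurrence,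
  against \<open>Bessel_J_large_order_pos\<close>.\<close>

lemma Bessel_J_Suc_nonzero:
  assumes "x > 0" "Bessel_J \<nu> x = 0"
  shows "Bessel_J (\<nu> + 1) x \<noteq> 0"
proof
  assume 1: "Bessel_J (\<nu> + 1) x = 0"
  have "Bessel_J (\<nu> + real k) x = 0 \<and> Bessel_J (\<nu> + real (k + 1)) x = 0" for k
  proof (induction k)
    case (Suc k)
    then show ?case using Bessel_J_order_rec[OF assms(1), of \<nu> k] by simp
  qed (use assms 1 in simp)
  then show False using Bessel_J_large_order_pos[OF assms(1), of \<nu>] by force
qed

text \<open>With \<open>Bessel_J_Suc_nonzero\<close>, every positive zero is simple.\<close>

lemma Bessel_J_deriv_at_zero:
  assumes "x > 0" "Bessel_J \<nu> x = 0"
  shows "(Bessel_J \<nu> has_field_derivative - Bessel_J (\<nu> + 1) x) (at x)"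
  using Bessel_J_deriv[OF assms(1), of \<nu>] assms(2) by simp

section \<open>The positive zeros of a Bessel function\<close>

text \<open>Otherwise zeros accumulate at some p in [0, M]. Positivity near 0 excludes p = 0;
  continuity or simplicity of the zero excludes p > 0.\<close>

lemma finite_bounded_Bessel_zeros:
  assumes "\<nu> > - 1"
  shows "finite ({x. x > 0 \<and> Bessel_J \<nu> x = 0} \<inter> {..M})" (is "finite ?S")
proof (rule ccontr)
  assume inf: "infinite ?S"
  have sub: "?S \<subseteq> {0..M}" by auto
  obtain p where p: "p \<in> {0..M}" "p islimpt ?S"
    using inf sub compact_Icc[of 0 M] by (meson Heine_Borel_imp_Bolzano_Weierstrass)
  have "\<forall>\<^sub>F y in at p. y \<notin> ?S"
  proof (cases "p = 0")
    case True
    have "\<forall>\<^sub>F y in at_right 0. y \<notin> ?S"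
      using Bessel_J_pos_near_0[OF assms] by eventually_elim auto
    moreover have "\<forall>\<^sub>F y in at_left 0. y \<notin> ?S"
      by (auto simp: eventually_at_filter)
    ultimately show ?thesis using True by (simp add: eventually_at_split)
  next
    case False
    then have p0: "p > 0" using p by simp
    have "\<forall>\<^sub>F y in at p. Bessel_J \<nu> y \<noteq> 0"
    proof (cases "Bessel_J \<nu> p = 0")
      case True
      have "((\<lambda>y. (Bessel_J \<nu> y - Bessel_J \<nu> p) / (y - p)) \<longlongrightarrow> - Bessel_J (\<nu> + 1) p) (at p)"
        using Bessel_J_deriv_at_zero[OF p0 True] by (simp add: has_field_derivative_iff)
      then have "\<forall>\<^sub>F y in at p. (Bessel_J \<nu> y - Bessel_J \<nu> p) / (y - p) \<noteq> 0"
        by (rule tendsto_imp_eventually_ne) (use Bessel_J_Suc_nonzero[OF p0 True] in simp)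
      then show ?thesis by eventually_elim (use True in auto)
    next
      case False
      have "(Bessel_J \<nu> \<longlongrightarrow> Bessel_J \<nu> p) (at p)"
        using isCont_Bessel_J[OF p0] by (simp add: isCont_def)
      then show ?thesis by (rule tendsto_imp_eventually_ne) (rule False)
    qed
    then show ?thesis by eventually_elim auto
  qed
  then show False using p(2) by (simp add: islimpt_iff_eventually)
qed

text \<open>
  Sturm comparison: \<open>u = \<surd>x J\<^sub>\<nu>\<close> satisfies \<open>u'' = - (1 + (1/4 - \<nu>\<^sup>2) / x\<^sup>2) u\<close>, where the factor is at
  least \<open>1/4\<close> for large \<open>x\<close>, so \<open>u\<close> cannot keep its sign on a half-period of \<open>sin ((x - A) / 2)\<close>.
\<close>
lemma Bessel_zero_exists:
  assumes A: "A \<ge> 2 * \<bar>\<nu>\<bar> + 1"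
  shows "\<exists>x\<ge>A. Bessel_J \<nu> x = 0"
proof (rule ccontr)
  assume "\<not> ?thesis"
  then have nz: "\<And>x. x \<ge> A \<Longrightarrow> Bessel_J \<nu> x \<noteq> 0" by auto
  have A0: "A > 0" using A by linarith
  define J where "J = Bessel_J \<nu>"
  define D where "D = (\<lambda>x. \<nu> / x * Bessel_J \<nu> x - Bessel_J (\<nu> + 1) x)"
  define \<sigma> where "\<sigma> = sgn (J A)"
  have J': "(J has_field_derivative D x) (at x)" if "x > 0" for x
    unfolding J_def D_def by (rule Bessel_J_deriv[OF that])
  \<comment> \<open>This is Bessel's differential equation, written for the derivative
    \<open>D\<close> of \<open>J\<close>.\<close>
  have D': "(D has_field_derivative (- D x / x - (1 - \<nu>\<^sup>2 / x\<^sup>2) * J x)) (at x)" if x: "x > 0" for x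
  proof -
    have "(D has_field_derivative (- \<nu> / x\<^sup>2 * J x + \<nu> / x * D x
        - ((\<nu> + 1) / x * Bessel_J (\<nu> + 1) x - Bessel_J (\<nu> + 1 + 1) x))) (at x)"
      unfolding D_def J_def using x
      by (auto intro!: derivative_eq_intros Bessel_J_deriv simp: power2_eq_square algebra_simps)
        (simp add: field_simps)
    moreover have "- \<nu> / x\<^sup>2 * J x + \<nu> / x * D x
        - ((\<nu> + 1) / x * Bessel_J (\<nu> + 1) x - Bessel_J (\<nu> + 1 + 1) x)
        = - D x / x - (1 - \<nu>\<^sup>2 / x\<^sup>2) * J x"
      using Bessel_J_rec[OF x, of \<nu>] x
      by (simp add: D_def J_def add.assoc) (simp add: field_simps power2_eq_square)
    ultimately show ?thesis by simp
  qed
  have pos: "\<sigma> * J x > 0" if x: "x \<ge> A" for x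
  proof (rule ccontr)
    assume "\<not> \<sigma> * J x > 0"
    then have le: "\<sigma> * J x \<le> 0" by simp
    have "\<sigma> * J A \<ge> 0" by (simp add: \<sigma>_def sgn_if)
    moreover have "\<forall>y. A \<le> y \<and> y \<le> x \<longrightarrow> isCont (\<lambda>y. \<sigma> * J y) y"
      using A0 by (auto simp: J_def intro!: continuous_intros isCont_Bessel_J)
    ultimately obtain y where "y \<ge> A" "\<sigma> * J y = 0" using IVT2[of "\<lambda>y. \<sigma> * J y" x 0 A] le x by auto
    moreover have "\<sigma> \<noteq> 0" using nz[of A] by (simp add: \<sigma>_def J_def sgn_if)
    ultimately show False using nz[of y] by (simp add: J_def)
  qed
  define u where "u = (\<lambda>x. sqrt x * J x)"
  define v where "v = (\<lambda>x. J x / (2 * sqrt x) + sqrt x * D x)"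
  have u': "(u has_field_derivative v x) (at x)" if x: "x > 0" for x
  proof -
    have "(u has_field_derivative inverse (sqrt x) / 2 * J x + D x * sqrt x) (at x)"
      unfolding u_def by (intro DERIV_mult DERIV_real_sqrt J' x)
    then show ?thesis by (simp add: v_def field_simps)
  qed
  have v': "(v has_field_derivative - (1 + (1/4 - \<nu>\<^sup>2) / x\<^sup>2) * u x) (at x)" if x: "x > 0" for x
  proof -
    \<comment> \<open>In terms of s = sqrt x the identity to be checked becomes rational.\<close>
    define s where "s = sqrt x"
    have s: "s > 0" "x = s\<^sup>2" using x by (auto simp: s_def)
    have "((\<lambda>x. 2 * sqrt x) has_field_derivative 2 * (inverse (sqrt x) / 2)) (at x)"
      by (intro DERIV_cmult DERIV_real_sqrt x)
    then have "(v has_field_derivative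
        (D x * (2 * sqrt x) - J x * (2 * (inverse (sqrt x) / 2))) / ((2 * sqrt x) * (2 * sqrt x))
        + (inverse (sqrt x) / 2 * D x + (- D x / x - (1 - \<nu>\<^sup>2 / x\<^sup>2) * J x) * sqrt x)) (at x)"
      unfolding v_def using x by (intro DERIV_add DERIV_mult DERIV_divide DERIV_real_sqrt J' D') auto
    moreover have "(d * (2 * s) - j * (2 * (inverse s / 2))) / ((2 * s) * (2 * s))
        + (inverse s / 2 * d + (- d / s\<^sup>2 - (1 - \<nu>\<^sup>2 / (s\<^sup>2)\<^sup>2) * j) * s)
        = - (1 + (1/4 - \<nu>\<^sup>2) / (s\<^sup>2)\<^sup>2) * (s * j)" for d j
      using s(1) by (simp add: divide_simps power2_eq_square) (simp add: algebra_simps)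
    from this[of "D x" "J x"] have "(D x * (2 * sqrt x) - J x * (2 * (inverse (sqrt x) / 2))) / ((2 * sqrt x) * (2 * sqrt x))
        + (inverse (sqrt x) / 2 * D x + (- D x / x - (1 - \<nu>\<^sup>2 / x\<^sup>2) * J x) * sqrt x)
        = - (1 + (1/4 - \<nu>\<^sup>2) / x\<^sup>2) * u x"
      unfolding u_def s(2)[symmetric] unfolding s_def .
    ultimately show ?thesis by simp
  qed
  \<comment> \<open>Up to the sign \<open>\<sigma>\<close>, the Wronskian of \<open>u\<close> and
    sin((x - A)/2). It cannot increase while \<open>\<sigma> * u\<close> and the sine are
    nonnegative, yet the cosine term makes it negative at A and positive at A + 2 pi.\<close>
  define g where "g = (\<lambda>x. \<sigma> * (v x * sin ((x - A) / 2) - u x * cos ((x - A) / 2) / 2))"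
  have g': "(g has_field_derivative
      \<sigma> * J x * sqrt x * sin ((x - A) / 2) * (1/4 - 1 - (1/4 - \<nu>\<^sup>2) / x\<^sup>2)) (at x)" if x: "x > 0" for x
  proof -
    define q where "q = (1/4 - \<nu>\<^sup>2) / x\<^sup>2"
    have v'': "(v has_field_derivative - (1 + q) * u x) (at x)" using v'[OF x] by (simp add: q_def)
    have "(g has_field_derivative \<sigma> * u x * sin ((x - A) / 2) * (1/4 - 1 - q)) (at x)"
      unfolding g_def by (auto intro!: derivative_eq_intros u'[OF x] v'' simp: field_simps)
    then show ?thesis by (simp add: u_def q_def mult_ac)
  qed
  have "g (A + 2 * pi) \<le> g A"
  proof (rule DERIV_nonpos_imp_nonincreasing[where f = g and a = A and b = "A + 2 * pi"])
    show "A \<le> A + 2 * pi" by simp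
    fix x assume x: "A \<le> x" "x \<le> A + 2 * pi"
    then have x0: "x > 0" using A0 by linarith
    have "4 * \<nu>\<^sup>2 \<le> x\<^sup>2"
      using power_mono[of "2 * \<bar>\<nu>\<bar>" x 2] x A by (simp add: power_mult_distrib)
    then have "4 * \<nu>\<^sup>2 \<le> 1 + 3 * x\<^sup>2" using zero_le_power2[of x] by linarith
    then have "(1/4 - 1 - (1/4 - \<nu>\<^sup>2) / x\<^sup>2) \<le> 0" using x0 by (simp add: field_simps)
    moreover have "\<sigma> * J x * sqrt x * sin ((x - A) / 2) \<ge> 0"
      using x0 x by (intro mult_nonneg_nonneg[OF mult_nonneg_nonneg[OF less_imp_le[OF pos]]] sin_ge_zero) auto
    ultimately have "\<sigma> * J x * sqrt x * sin ((x - A) / 2) * (1/4 - 1 - (1/4 - \<nu>\<^sup>2) / x\<^sup>2) \<le> 0"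
      by (simp add: mult_nonneg_nonpos)
    then show "\<exists>y. (g has_field_derivative y) (at x) \<and> y \<le> 0" using g'[OF x0] by blast
  qed
  moreover have "g A < 0"
    using pos[of A] A0 mult_pos_pos[of "sqrt A" "\<sigma> * J A"] by (simp add: g_def u_def mult_ac)
  moreover have "A + 2 * pi > 0" using A0 pi_gt_zero by linarith
  then have "g (A + 2 * pi) > 0"
    using pos[of "A + 2 * pi"] A0 mult_pos_pos[of "sqrt (A + 2 * pi)" "\<sigma> * J (A + 2 * pi)"]
    by (simp add: g_def u_def mult_ac)
  ultimately show False by linarith
qed

lemma infinite_Bessel_zeros:
  "infinite {x. x > 0 \<and> Bessel_J \<nu> x = 0}" (is "infinite ?Z")
proof
  assume "finite ?Z"
  then have "bdd_above ?Z" by (rule bdd_above_finite)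
  then obtain M where M: "\<And>x. x \<in> ?Z \<Longrightarrow> x \<le> M" by (auto simp: bdd_above_def)
  obtain x where x: "x \<ge> 2 * \<bar>\<nu>\<bar> + 1" "x \<ge> M + 1" "Bessel_J \<nu> x = 0"
    using Bessel_zero_exists[of \<nu> "max (2 * \<bar>\<nu>\<bar> + 1) (M + 1)"] by auto
  then have "x > 0" by linarith
  with M[of x] x show False by auto
qed

section \<open>Lommel polynomials\<close>

text \<open>The binomial coefficients vanish beyond n/2, so sums for different n can share summation
  ranges in the recurrence.\<close>

lemma Lommel_R_eq_sum:
  assumes "n div 2 \<le> N"
  shows "Lommel_R n \<mu> x =
     (\<Sum>k\<le>N. (- 1) ^ k * real ((n - k) choose k)
        * (Gamma (\<mu> + real n - real k) / Gamma (\<mu> + real k))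
        * (x / 2) powi (2 * int k - int n))"
proof -
  have "(n - k) choose k = 0" if "k \<in> {..N} - {0..n div 2}" for k
    using that by (intro binomial_eq_0) auto
  then show ?thesis
    unfolding Lommel_R_def using assms by (intro sum.mono_neutral_left) auto
qed

lemma Lommel_R_0: "\<mu> > 0 \<Longrightarrow> Lommel_R 0 \<mu> x = 1"
  by (simp add: Lommel_R_def Gamma_eq_zero_iff nonpos_Ints_def)

lemma Lommel_R_1:
  assumes "\<mu> > 0" "x > 0"
  shows "Lommel_R 1 \<mu> x = 2 * \<mu> / x"
proof -
  have "Gamma \<mu> > 0" using assms by (intro Gamma_real_pos)
  moreover have "Gamma (\<mu> + 1) = \<mu> * Gamma \<mu>"
    using assms by (intro Gamma_plus1) (auto elim!: nonpos_Ints_cases)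
  ultimately show ?thesis by (simp add: Lommel_R_def power_int_minus field_simps)
qed

text \<open>Term k of R_n has the same power of x as term k + 1 of R_(n+2). Comparing coefficients
  leaves an identity between binomials, settled by Pascal's rule and absorption.\<close>

lemma Lommel_R_rec:
  assumes "\<mu> > 0" "x > 0"
  shows "Lommel_R (n + 2) \<mu> x = 2 * (\<mu> + real n + 1) / x * Lommel_R (n + 1) \<mu> x - Lommel_R n \<mu> x"
proof -
  define T where "T = (\<lambda>n k. (- 1) ^ k * real ((n - k) choose k)
        * (Gamma (\<mu> + real n - real k) / Gamma (\<mu> + real k))
        * (x / 2) powi (2 * int k - int n))"
  define c where "c = 2 * (\<mu> + real n + 1) / x"
  have G: "Gamma (z + 1) = z * Gamma z" "Gamma z > 0" if "z > 0" for z :: real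
    using that by (auto intro!: Gamma_plus1 Gamma_real_pos elim!: nonpos_Ints_cases)
  have x2: "x / 2 \<noteq> 0" using assms by simp
  have 0: "T (n + 2) 0 = c * T (n + 1) 0"
  proof -
    have "(x / 2) powi (- int (n + 1)) = (x / 2) powi (- int (n + 2)) * (x / 2)"
      using power_int_add_1[of "x / 2" "- int (n + 2)"] x2 by simp
    moreover have "Gamma (\<mu> + real (n + 2)) = (\<mu> + real n + 1) * Gamma (\<mu> + real (n + 1))"
      using G(1)[of "\<mu> + real n + 1"] assms by (simp add: add_ac)
    moreover have "T (n + 2) 0 = Gamma (\<mu> + real (n + 2)) / Gamma \<mu> * (x / 2) powi (- int (n + 2))"
      "T (n + 1) 0 = Gamma (\<mu> + real (n + 1)) / Gamma \<mu> * (x / 2) powi (- int (n + 1))"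
      by (simp_all add: T_def)
    moreover have "\<mu> + real n + 1 = c * (x / 2)" using assms by (simp add: c_def)
    ultimately show ?thesis by (simp only: times_divide_eq_left times_divide_eq_right
        divide_divide_eq_left mult_ac)
  qed
  have S: "T (n + 2) (Suc k) = c * T (n + 1) (Suc k) - T n k" for k
  proof (cases "2 * k \<le> n")
    case False
    then have "(n + 2 - Suc k) choose Suc k = 0" "(n + 1 - Suc k) choose Suc k = 0"
      "(n - k) choose k = 0" by (auto intro!: binomial_eq_0)
    then show ?thesis by (simp only: T_def)
  next
    case True
    then have kn: "k \<le> n" by simp
    define P where "P = (x / 2) powi (2 * int k - int n)"
    define A where "A = real ((n - k) choose k)"
    define B where "B = real ((n - k) choose Suc k)"
    define g where "g = Gamma (\<mu> + real n - real k)"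
    define h where "h = Gamma (\<mu> + real k)"
    have p: "\<mu> + real n - real k > 0" "\<mu> + real k > 0" using kn assms by auto
    have h: "h > 0" using G(2)[OF p(2)] by (simp add: h_def)
    have P1: "(x / 2) powi (2 * int (Suc k) - int (n + 1)) = P * (x / 2)"
      using power_int_add_1[of "x / 2" "2 * int k - int n"] x2 by (simp add: P_def algebra_simps)
    have P2: "(x / 2) powi (2 * int (Suc k) - int (n + 2)) = P" by (simp add: P_def algebra_simps)
    have N1: "(n + 1 - Suc k) = n - k" "n + 2 - Suc k = Suc (n - k)" using kn by auto
    have g1: "Gamma (\<mu> + real (n + 2) - real (Suc k)) = (\<mu> + real n - real k) * g"
      using G(1)[OF p(1)] by (simp add: g_def algebra_simps)
    have g2: "Gamma (\<mu> + real (n + 1) - real (Suc k)) = g" by (simp add: g_def algebra_simps)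
    have h1: "Gamma (\<mu> + real (Suc k)) = (\<mu> + real k) * h"
      using G(1)[OF p(2)] by (simp add: h_def algebra_simps)
    \<comment> \<open>Absorption expresses \<open>B\<close> through \<open>A\<close>; Pascal's rule
      enters as the sum \<open>A + B\<close> in \<open>T2\<close>.\<close>
    have "Suc k * ((n - k) choose Suc k) = (n - k - k) * ((n - k) choose k)"
      using binomial_absorption[of k "n - k"] binomial_absorb_comp[of "n - k" k] by simp
    then have "real (Suc k) * B = real (n - k - k) * A"
      unfolding A_def B_def by (metis of_nat_mult)
    then have AB: "(real k + 1) * B = (real n - 2 * real k) * A"
      using True by (simp add: of_nat_diff add.commute)
    have T2: "T (n + 2) (Suc k) = - ((- 1) ^ k) * (A + B) * ((\<mu> + real n - real k) * g / ((\<mu> + real k) * h)) * P"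
      unfolding T_def N1 g1 h1 P2 by (simp add: A_def B_def)
    have T1: "T (n + 1) (Suc k) = - ((- 1) ^ k) * B * (g / ((\<mu> + real k) * h)) * (P * (x / 2))"
      unfolding T_def N1 g2 h1 P1 by (simp add: B_def)
    have T0: "T n k = (- 1) ^ k * A * (g / h) * P"
      unfolding T_def by (simp add: A_def g_def h_def P_def)
    have "(A + B) * (\<mu> + real n - real k) = (\<mu> + real n + 1) * B + A * (\<mu> + real k)"
      using AB by (simp add: algebra_simps)
    then have key: "(A + B) * (\<mu> + real n - real k) / (\<mu> + real k)
        = (\<mu> + real n + 1) * B / (\<mu> + real k) + A"
      using p(2) by (simp add: field_simps)
    have "T (n + 2) (Suc k) = - ((- 1) ^ k) * ((A + B) * (\<mu> + real n - real k) / (\<mu> + real k)) * (g / h * P)"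
      unfolding T2 by simp
    also have "\<dots> = c * T (n + 1) (Suc k) - T n k"
    proof -
      have "- \<sigma> * (N * B / r + A) * (g / h * P)
          = 2 * N / x * (- \<sigma> * B * (g / (r * h)) * (P * (x / 2))) - \<sigma> * A * (g / h) * P"
        if "r > 0" for \<sigma> N r :: real
        using that assms h by (simp add: field_simps)
      from this[OF p(2)] show ?thesis unfolding key T1 T0 c_def .
    qed
    finally show ?thesis .
  qed
  have "Lommel_R (n + 2) \<mu> x = (\<Sum>k\<le>Suc n. T (n + 2) k)"
    unfolding T_def by (rule Lommel_R_eq_sum) simp
  also have "\<dots> = T (n + 2) 0 + (\<Sum>k\<le>n. T (n + 2) (Suc k))" by (rule sum.atMost_Suc_shift)
  also have "\<dots> = c * (T (n + 1) 0 + (\<Sum>k\<le>n. T (n + 1) (Suc k))) - (\<Sum>k\<le>n. T n k)"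
    unfolding 0 S by (simp add: sum_subtractf sum_distrib_left algebra_simps)
  also have "T (n + 1) 0 + (\<Sum>k\<le>n. T (n + 1) (Suc k)) = (\<Sum>k\<le>Suc n. T (n + 1) k)"
    by (rule sum.atMost_Suc_shift[symmetric])
  also have "\<dots> = Lommel_R (n + 1) \<mu> x"
    unfolding T_def by (rule Lommel_R_eq_sum[symmetric]) simp
  also have "(\<Sum>k\<le>n. T n k) = Lommel_R n \<mu> x"
    unfolding T_def by (rule Lommel_R_eq_sum[symmetric]) simp
  finally show ?thesis by (simp add: c_def)
qed

text \<open>The case k = 0 encodes R_(-1) = 0; truncated subtraction would give R_0 there. With it
  the recurrence of J_(\<nu>+k) holds from k = 0 on, with initial values 0 and 1.\<close>

definition lom :: "real \<Rightarrow> nat \<Rightarrow> real \<Rightarrow> real" where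
  "lom \<nu> k x = (if k = 0 then 0 else Lommel_R (k - 1) (\<nu> + 1) x)"

lemma lom_0: "lom \<nu> 0 x = 0"
  by (simp add: lom_def)

lemma lom_1: "\<nu> > - 1 \<Longrightarrow> lom \<nu> 1 x = 1"
  by (simp add: lom_def Lommel_R_0)

lemma lom_rec:
  assumes "\<nu> > - 1" "x > 0"
  shows "lom \<nu> (k + 2) x = 2 * (\<nu> + real k + 1) / x * lom \<nu> (k + 1) x - lom \<nu> k x"
proof (cases k)
  case 0
  then show ?thesis using assms Lommel_R_0[of "\<nu> + 1"] Lommel_R_1[of "\<nu> + 1" x] by (simp add: lom_def)
next
  case (Suc j)
  then show ?thesis using assms Lommel_R_rec[of "\<nu> + 1" x j] by (simp add: lom_def algebra_simps)
qed

text \<open>Only differentiability matters: the recurrence in k replaces any explicit formula for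
  the derivative.\<close>

lemma lom_deriv:
  assumes "x > 0"
  shows "(lom \<nu> k has_field_derivative deriv (lom \<nu> k) x) (at x)"
proof (cases k)
  case 0
  then have "lom \<nu> k = (\<lambda>x. 0)" by (simp add: lom_def fun_eq_iff)
  then show ?thesis by simp
next
  case (Suc n)
  have "(\<lambda>x. Lommel_R n (\<nu> + 1) x) field_differentiable (at x)"
    unfolding Lommel_R_def field_differentiable_def using assms
    by (intro exI) (rule derivative_eq_intros refl | use assms in simp)+
  moreover have "lom \<nu> k = (\<lambda>x. Lommel_R n (\<nu> + 1) x)" using Suc by (simp add: lom_def fun_eq_iff)
  ultimately show ?thesis by (simp add: field_differentiable_derivI)
qed

text \<open>For x \<le> \<nu> + 1 the middle coefficient of the recurrence is at least 2, so
  positivity and monotonicity in k propagate together.\<close>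

lemma lom_pos:
  assumes "\<nu> > - 1" "x > 0" "x \<le> \<nu> + 1"
  shows "lom \<nu> (Suc k) x > 0"
proof -
  have "lom \<nu> (Suc k) x > 0 \<and> lom \<nu> (Suc k) x \<ge> lom \<nu> k x"
  proof (induction k)
    case 0
    then show ?case using lom_1[OF assms(1)] by (simp add: lom_0)
  next
    case (Suc k)
    have "2 * x \<le> 2 * (\<nu> + real k + 1)" using assms by simp
    then have "2 \<le> 2 * (\<nu> + real k + 1) / x" using assms by (simp add: field_simps)
    then have "2 * lom \<nu> (Suc k) x \<le> 2 * (\<nu> + real k + 1) / x * lom \<nu> (Suc k) x"
      using Suc by (intro mult_right_mono) auto
    then show ?case using Suc lom_rec[OF assms(1,2), of k] by simp
  qed
  then show ?thesis ..
qed

section \<open>Monotonicity of the Green function\<close>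

text \<open>Allows identities known only for positive arguments to be differentiated.\<close>

lemma derivative_unique_open:
  assumes "(f has_field_derivative a) (at x)" "(g has_field_derivative b) (at x)"
    and "x > 0" "\<And>y::real. y > 0 \<Longrightarrow> f y = g y"
  shows "a = (b::real)"
proof -
  have "(f has_field_derivative b) (at x)"
    by (rule has_field_derivative_transform_within_open[OF assms(2), of "{0<..}"]) (use assms in auto)
  then show ?thesis using assms(1) DERIV_unique by blast
qed

text \<open>Differentiating the recurrence in x, the terms with 2p/x cancel in the Casoratian. Its
  change from one index to the next is a multiple of a square, so its sign is controlled by that of
  p.\<close>

lemma three_term_casoratian:
  fixes u0 u1 u2 :: "real \<Rightarrow> real"
  assumes rec: "\<And>y. y > 0 \<Longrightarrow> u2 y = 2 * p / y * u1 y - u0 y"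
    and d: "(u0 has_field_derivative d0) (at x)" "(u1 has_field_derivative d1) (at x)"
      "(u2 has_field_derivative d2) (at x)"
    and x: "x > 0"
  shows "d2 * u1 x - d1 * u2 x = d1 * u0 x - d0 * u1 x - 2 * p / x\<^sup>2 * (u1 x)\<^sup>2"
proof -
  have "((\<lambda>y. 2 * p / y * u1 y - u0 y) has_field_derivative
      (- (2 * p) / x\<^sup>2 * u1 x + 2 * p / x * d1 - d0)) (at x)"
    using x by (auto intro!: derivative_eq_intros d simp: power2_eq_square)
        (simp add: field_simps)
  then have d2: "d2 = - (2 * p) / x\<^sup>2 * u1 x + 2 * p / x * d1 - d0"
    by (rule derivative_unique_open[OF d(3)]) (use x rec in auto)
  show ?thesis
    unfolding d2 rec[OF x] power2_eq_square[of "u1 x"] by (simp add: algebra_simps)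
qed

text \<open>Since u_k has coefficient -1 in the recurrence, the Casoratian does not depend on k; its
  value is read off at k = 0.\<close>

lemma casoratian:
  assumes "\<nu> > - 1" "x > 0"
  shows "lom \<nu> (k + 1) x * Bessel_J (\<nu> + real k) x - lom \<nu> k x * Bessel_J (\<nu> + real (k + 1)) x
    = Bessel_J \<nu> x"
proof (induction k)
  case 0
  then show ?case using lom_1[OF assms(1)] by (simp add: lom_0)
next
  case (Suc k)
  have "lom \<nu> (k + 2) x * Bessel_J (\<nu> + real (k + 1)) x - lom \<nu> (k + 1) x * Bessel_J (\<nu> + real (k + 2)) x
      = lom \<nu> (k + 1) x * Bessel_J (\<nu> + real k) x - lom \<nu> k x * Bessel_J (\<nu> + real (k + 1)) x"
    unfolding lom_rec[OF assms] Bessel_J_order_rec[OF assms(2)] by (simp add: algebra_simps)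
  then show ?case using Suc by simp
qed

section \<open>Signs of the Casoratians at a fixed point x\<close>

context
  fixes \<nu> x :: real
  assumes \<nu>: "\<nu> > - 1" and x: "x > 0"
begin

abbreviation (input) J where "J k \<equiv> Bessel_J (\<nu> + real k) x"
abbreviation (input) L where "L k \<equiv> lom \<nu> k x"
abbreviation (input) J' where "J' k \<equiv> deriv (Bessel_J (\<nu> + real k)) x"
abbreviation (input) L' where "L' k \<equiv> deriv (lom \<nu> k) x"

lemma J_deriv: "(Bessel_J (\<nu> + real k) has_field_derivative J' k) (at x)"
  using Bessel_J_deriv[OF x, of "\<nu> + real k"] by (simp add: DERIV_imp_deriv)

text \<open>Telescoping up from k = 0, where \<open>L 0\<close> and \<open>L' 0\<close> vanish: the
  first increment is strictly negative and the later ones are at most 0.\<close>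

lemma L_casoratian_neg: "L' (k + 2) * L (k + 1) - L' (k + 1) * L (k + 2) < 0"
proof (induction k)
  case 0
  have "L' 0 = 0" by (simp add: lom_def[abs_def])
  then have "L' 2 * L 1 - L' 1 * L 2 = - (2 * (\<nu> + 1) / x\<^sup>2)"
    using three_term_casoratian[of "lom \<nu> (0 + 2)" "\<nu> + real 0 + 1" "lom \<nu> (0 + 1)" "lom \<nu> 0",
        OF lom_rec[OF \<nu>] lom_deriv lom_deriv lom_deriv x] x lom_1[OF \<nu>, of x]
    by (simp add: lom_0 numeral_2_eq_2)
  also have "\<dots> < 0" using \<nu> x by simp
  finally show ?case by (simp add: numeral_2_eq_2)
next
  case (Suc k)
  have "L' (k + 3) * L (k + 2) - L' (k + 2) * L (k + 3)
      = L' (k + 2) * L (k + 1) - L' (k + 1) * L (k + 2) - 2 * (\<nu> + real (k + 1) + 1) / x\<^sup>2 * (L (k + 2))\<^sup>2"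
    using three_term_casoratian[of "lom \<nu> (k + 1 + 2)" "\<nu> + real (k + 1) + 1" "lom \<nu> (k + 1 + 1)" "lom \<nu> (k + 1)",
        OF lom_rec[OF \<nu>] lom_deriv lom_deriv lom_deriv x] x
    by (simp add: numeral_eq_Suc)
  moreover have "2 * (\<nu> + real (k + 1) + 1) / x\<^sup>2 * (L (k + 2))\<^sup>2 \<ge> 0" using \<nu> by simp
  ultimately show ?case using Suc by (simp add: numeral_eq_Suc)
qed

lemma J_casoratian_Suc:
  "J' (k + 2) * J (k + 1) - J' (k + 1) * J (k + 2)
    = J' (k + 1) * J k - J' k * J (k + 1) - 2 * (\<nu> + real k + 1) / x\<^sup>2 * (J (k + 1))\<^sup>2"
  by (rule three_term_casoratian[of "Bessel_J (\<nu> + real (k + 2))" "\<nu> + real k + 1"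
        "Bessel_J (\<nu> + real (k + 1))" "Bessel_J (\<nu> + real k)",
        OF Bessel_J_order_rec J_deriv J_deriv J_deriv x])

text \<open>Telescoping down from infinity: the expression is nonincreasing in k and tends to
  0.\<close>

lemma J_casoratian_nonneg: "J' (k + 1) * J k - J' k * J (k + 1) \<ge> 0"
proof -
  define V where "V = (\<lambda>k. J' (k + 1) * J k - J' k * J (k + 1))"
  have "V (Suc k) \<le> V k" for k
  proof -
    have "2 * (\<nu> + real k + 1) / x\<^sup>2 * (J (k + 1))\<^sup>2 \<ge> 0" using \<nu> by simp
    then show ?thesis using J_casoratian_Suc[of k] by (simp add: V_def)
  qed
  then have dec: "decseq V" by (rule decseq_SucI)
  have lim0: "(\<lambda>k. J (k + i)) \<longlonglongrightarrow> 0" for i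
    using LIMSEQ_ignore_initial_segment[OF Bessel_J_order_tendsto_0[OF x, of \<nu>], of i] .
  \<comment> \<open>This form of the derivative avoids the unbounded coefficient (\<nu> + k + 1)/x.
    It starts at index 1, so the limit of \<open>V\<close> is taken along k + 1.\<close>
  have d: "J' (k + 1) = (J k - J (k + 2)) / 2" for k
  proof -
    define r where "r = (\<nu> + real k + 1) / x"
    have *: "d = (a - c) / 2" if "d = e - c" "c = 2 * e - a" for a c d e :: real
      unfolding that by (simp add: field_simps)
    have 1: "J' (k + 1) = r * J (k + 1) - J (k + 2)"
      using Bessel_J_deriv[OF x, of "\<nu> + real (k + 1)"]
      by (simp add: DERIV_imp_deriv add_ac r_def)
    have 2: "J (k + 2) = 2 * (r * J (k + 1)) - J k"
      using Bessel_J_order_rec[OF x, of \<nu> k] by (simp add: r_def)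
    show ?thesis by (rule *[OF 1 2])
  qed
  have "V (k + 1) = (J (k + 1) - J (k + 3)) / 2 * J (k + 1) - (J k - J (k + 2)) / 2 * J (k + 2)" for k
    unfolding V_def d by (simp add: add_ac)
  moreover have "(\<lambda>k. (J (k + 1) - J (k + 3)) / 2 * J (k + 1) - (J (k + 0) - J (k + 2)) / 2 * J (k + 2))
      \<longlonglongrightarrow> (0 - 0) / 2 * 0 - (0 - 0) / 2 * 0"
    by (intro tendsto_intros lim0) auto
  ultimately have "(\<lambda>k. V (k + 1)) \<longlonglongrightarrow> 0" by simp
  then have "V \<longlonglongrightarrow> 0" by (rule LIMSEQ_offset)
  then have "V k \<ge> 0" using decseq_ge[OF dec] by blast
  then show ?thesis by (simp add: V_def)
qed

text \<open>The step from k to k + 1 strictly decreases the expression and still ends at a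
  nonnegative value.\<close>

lemma J_casoratian_pos:
  assumes "J (k + 1) \<noteq> 0"
  shows "J' (k + 1) * J k - J' k * J (k + 1) > 0"
proof -
  have "2 * (\<nu> + real k + 1) / x\<^sup>2 * (J (k + 1))\<^sup>2 > 0" using \<nu> x assms by simp
  then show ?thesis using J_casoratian_Suc[of k] J_casoratian_nonneg[of "k + 1"]
    by (simp add: numeral_eq_Suc)
qed

lemma green_deriv_pos:
  assumes "m \<ge> 1" and nz: "Bessel_J \<nu> x \<noteq> 0"
  shows "\<exists>D>0. ((\<lambda>y. lom \<nu> m y * Bessel_J (\<nu> + real m) y / Bessel_J \<nu> y) has_field_derivative D) (at x)"
proof -
  obtain k where k: "m = k + 1" using assms by (metis Suc_eq_plus1 Suc_le_D One_nat_def)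
  define a where "a = L m"
  define a' where "a' = L' m"
  define A where "A = L (m + 1)"
  define A' where "A' = L' (m + 1)"
  define b where "b = J m"
  define b' where "b' = J' m"
  define B where "B = J (m + 1)"
  define B' where "B' = J' (m + 1)"
  define z where "z = Bessel_J \<nu> x"
  define z' where "z' = deriv (Bessel_J \<nu>) x"
  note defs = a_def a'_def A_def A'_def b_def b'_def B_def B'_def z_def z'_def
  have z: "z = A * b - a * B" using casoratian[OF \<nu> x, of m] by (simp add: defs)
  have dz: "(Bessel_J \<nu> has_field_derivative z') (at x)" using J_deriv[of 0] by (simp add: defs)
  have "((\<lambda>y. lom \<nu> (m + 1) y * Bessel_J (\<nu> + real m) y - lom \<nu> m y * Bessel_J (\<nu> + real (m + 1)) y)
      has_field_derivative (A' * b + b' * A) - (a' * B + B' * a)) (at x)"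
    unfolding defs by (intro DERIV_diff DERIV_mult lom_deriv J_deriv x)
  then have z': "z' = (A' * b + b' * A) - (a' * B + B' * a)"
    by (rule derivative_unique_open[OF dz _ x]) (simp only: casoratian[OF \<nu>])
  have F: "((\<lambda>y. lom \<nu> m y * Bessel_J (\<nu> + real m) y / Bessel_J \<nu> y) has_field_derivative
      ((a' * b + b' * a) * z - (a * b) * z') / (z * z)) (at x)"
    using nz dz unfolding defs by (intro DERIV_divide DERIV_mult lom_deriv J_deriv x)
  \<comment> \<open>After inserting \<open>z\<close> and \<open>z'\<close> from the Casoratian
    identity, the quotient rule numerator splits into two squares weighted by Casoratians.\<close>
  have num: "(a' * b + b' * a) * z - (a * b) * z' = b\<^sup>2 * (a' * A - A' * a) + a\<^sup>2 * (B' * b - b' * B)"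
    unfolding z z' by (simp add: algebra_simps power2_eq_square)
  have L: "a' * A - A' * a > 0" using L_casoratian_neg[of k] by (simp add: defs k)
  have V: "B' * b - b' * B \<ge> 0" using J_casoratian_nonneg[of m] by (simp add: defs)
  have z0: "z \<noteq> 0" using nz by (simp add: defs)
  \<comment> \<open>If b = 0, then z = -aB is nonzero, so the second summand is strictly positive
    instead of the first.\<close>
  have pos: "b\<^sup>2 * (a' * A - A' * a) + a\<^sup>2 * (B' * b - b' * B) > 0"
  proof (cases "b = 0")
    case True
    then have "a \<noteq> 0" "B \<noteq> 0" using z z0 by auto
    moreover have "B' * b - b' * B > 0"
      using J_casoratian_pos[of m] \<open>B \<noteq> 0\<close> by (simp add: defs)
    ultimately have "a\<^sup>2 * (B' * b - b' * B) > 0" by (intro mult_pos_pos) auto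
    then show ?thesis using True by simp
  next
    case False
    then show ?thesis using L V by (intro add_pos_nonneg) auto
  qed
  have "((a' * b + b' * a) * z - (a * b) * z') / (z * z) > 0"
    unfolding num using z0 by (intro divide_pos_pos pos) (auto simp: zero_less_mult_iff linorder_neq_iff)
  then show ?thesis using F by blast
qed

end

section \<open>Enumeration and interlacing\<close>

lemma locally_finite_has_least:
  fixes Z :: "real set"
  assumes "\<And>M. finite (Z \<inter> {..M})" "Y \<subseteq> Z" "Y \<noteq> {}"
  shows "\<exists>z\<in>Y. \<forall>y\<in>Y. z \<le> y"
proof -
  obtain y0 where y0: "y0 \<in> Y" using assms by auto
  have fin: "finite (Y \<inter> {..y0})" using finite_subset[OF _ assms(1)[of y0]] assms(2) by blast
  define z where "z = Min (Y \<inter> {..y0})"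
  have z: "z \<in> Y \<inter> {..y0}" unfolding z_def using fin y0 by (intro Min_in) auto
  have "z \<le> y" if "y \<in> Y" for y
  proof (cases "y \<le> y0")
    case True
    then show ?thesis unfolding z_def using fin that by (intro Min_le) auto
  qed (use z in auto)
  then show ?thesis using z by auto
qed

text \<open>Starting from the least element, pass repeatedly to the next larger one. A missed z
  would lie above the infinitely many values chosen.\<close>

lemma locally_finite_enumeration:
  fixes Z :: "real set"
  assumes fin: "\<And>M. finite (Z \<inter> {..M})" and inf: "infinite Z"
  shows "\<exists>a::nat \<Rightarrow> real. strict_mono a \<and> range a = Z"
proof -
  have ex: "\<exists>z\<in>Z. z > x \<and> (\<forall>y\<in>Z. x < y \<longrightarrow> z \<le> y)" for x
  proof -
    have "Z \<inter> {x<..} \<noteq> {}"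
    proof
      assume "Z \<inter> {x<..} = {}"
      then have "Z = Z \<inter> {..x}" by force
      then show False using fin[of x] inf by simp
    qed
    then show ?thesis using locally_finite_has_least[OF fin, of "Z \<inter> {x<..}"] by auto
  qed
  have "Z \<noteq> {}" using inf by auto
  then obtain z0 where z0: "z0 \<in> Z" "\<And>y. y \<in> Z \<Longrightarrow> z0 \<le> y"
    using locally_finite_has_least[OF fin, of Z] by auto
  have "\<exists>a. \<forall>n. (a n \<in> Z \<and> (n = (0::nat) \<longrightarrow> a n = z0))
      \<and> (a (Suc n) > a n \<and> (\<forall>y\<in>Z. a n < y \<longrightarrow> a (Suc n) \<le> y))"
  proof (rule dependent_nat_choice)
    show "\<exists>z. z \<in> Z \<and> ((0::nat) = 0 \<longrightarrow> z = z0)" using z0 by auto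
    fix x and n :: nat
    show "\<exists>y. (y \<in> Z \<and> (Suc n = 0 \<longrightarrow> y = z0)) \<and> (y > x \<and> (\<forall>z\<in>Z. x < z \<longrightarrow> y \<le> z))"
      using ex[of x] by auto
  qed
  then obtain a :: "nat \<Rightarrow> real" where a: "\<And>n. a n \<in> Z \<and> (n = 0 \<longrightarrow> a n = z0)"
      "\<And>n. a (Suc n) > a n \<and> (\<forall>y\<in>Z. a n < y \<longrightarrow> a (Suc n) \<le> y)"
    by blast
  have mono: "strict_mono a" using a(2) by (simp add: strict_mono_Suc_iff)
  have "z \<in> range a" if z: "z \<in> Z" for z
  proof (rule ccontr)
    assume nz: "z \<notin> range a"
    have "a n < z" for n
    proof (induction n)
      case 0
      then show ?case using a(1)[of 0] z0(2)[OF z] nz by (metis order_le_less rangeI)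
    next
      case (Suc n)
      then have "a (Suc n) \<le> z" using a(2)[of n] z by auto
      then show ?case using nz by (metis order_le_less rangeI)
    qed
    then have "range a \<subseteq> Z \<inter> {..z}" using a(1) by (auto intro: less_imp_le)
    then have "finite (range a)" using fin[of z] finite_subset by blast
    then show False using range_inj_infinite[OF strict_mono_imp_inj_on[OF mono]] by simp
  qed
  then have "range a = Z" using a(1) by auto
  then show ?thesis using mono by blast
qed

text \<open>The unique points in the gaps of \<open>j\<close> increase and exhaust S, so they are
  its enumeration. As \<open>j\<close> counts from 0, \<open>j (k - 1)\<close> is its k-th
  value.\<close>

lemma kth_element_interlacing:
  fixes j :: "nat \<Rightarrow> real" and S :: "real set"
  assumes mono: "strict_mono j" and unbounded: "\<And>M. \<exists>n. j n > M"
    and ex1: "\<And>n. \<exists>!s. s \<in> S \<and> j n < s \<and> s < j (Suc n)"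
    and disj: "S \<inter> range j = {}" and low: "\<And>s. s \<in> S \<Longrightarrow> j 0 \<le> s"
    and k: "k \<ge> 1"
  shows "j (k - 1) < kth_element S k \<and> kth_element S k < j k"
proof -
  define w where "w = (\<lambda>n. THE s. s \<in> S \<and> j n < s \<and> s < j (Suc n))"
  have w: "w n \<in> S \<and> j n < w n \<and> w n < j (Suc n)" for n
    unfolding w_def by (rule theI') (rule ex1)
  have "w n < w (Suc n)" for n using w[of n] w[of "Suc n"] by linarith
  then have "strict_mono w" by (simp add: strict_mono_Suc_iff)
  moreover have "s \<in> range w" if s: "s \<in> S" for s
  proof -
    \<comment> \<open>The first value of \<open>j\<close> above s closes the gap containing
      s.\<close>
    define N where "N = (LEAST n. j n > s)"
    have N: "j N > s" unfolding N_def using unbounded[of s] by (rule LeastI_ex)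
    have "N \<noteq> 0" using low[OF s] N by (metis linorder_not_less)
    then obtain n where n: "N = Suc n" by (cases N) auto
    have "\<not> j n > s" using not_less_Least[of n "\<lambda>n. j n > s"] n by (simp add: N_def)
    moreover have "j n \<noteq> s" using disj s by auto
    ultimately have "j n < s" by simp
    then have "s = w n" using ex1[of n] w[of n] s N n by blast
    then show ?thesis by simp
  qed
  then have "range w = S" using w by auto
  ultimately have "kth_element S k = w (k - 1)" by (rule kth_element_eq)
  then show ?thesis using w[of "k - 1"] k by simp
qed

section \<open>Zeros forced by sign changes\<close>

lemma IVT_sign_change:
  fixes f :: "real \<Rightarrow> real"
  assumes "a < b" "f a * f b < 0" "\<And>x. a \<le> x \<Longrightarrow> x \<le> b \<Longrightarrow> isCont f x"
  shows "\<exists>x>a. x < b \<and> f x = 0"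
proof -
  have "\<exists>x\<ge>a. x \<le> b \<and> f x = 0"
  proof (cases "f a < 0")
    case True
    then have "f b > 0" using assms(2) by (simp add: mult_less_0_iff)
    then show ?thesis using IVT[of f a 0 b] True assms by auto
  next
    case False
    then have "f a > 0" "f b < 0" using assms(2) by (auto simp: mult_less_0_iff)
    then show ?thesis using IVT2[of f b 0 a] assms by auto
  qed
  then obtain x where x: "x \<ge> a" "x \<le> b" "f x = 0" by blast
  moreover have "x \<noteq> a" "x \<noteq> b" using x assms(2) by auto
  ultimately show ?thesis by (intro exI[of _ x]) auto
qed

text \<open>With equal slope signs, f has opposite signs just after p and just before q. Hence
  consecutive simple zeros have slopes of opposite sign.\<close>

lemma zero_between_same_slope:
  fixes f :: "real \<Rightarrow> real"
  assumes pq: "p < q" and f0: "f p = 0" "f q = 0"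
    and dp: "(f has_field_derivative d) (at p)" and dq: "(f has_field_derivative e) (at q)"
    and de: "d * e > 0" and cont: "\<And>x. p \<le> x \<Longrightarrow> x \<le> q \<Longrightarrow> isCont f x"
  shows "\<exists>x>p. x < q \<and> f x = 0"
proof -
  have main: "\<exists>x>p. x < q \<and> g x = 0"
    if g: "g p = 0" "g q = 0" "(g has_field_derivative d') (at p)" "(g has_field_derivative e') (at q)"
      "d' > 0" "e' > 0" "\<And>x. p \<le> x \<Longrightarrow> x \<le> q \<Longrightarrow> isCont g x" for g :: "real \<Rightarrow> real" and d' e'
  proof -
    obtain \<delta>1 where 1: "\<delta>1 > 0" "\<And>h. 0 < h \<Longrightarrow> h < \<delta>1 \<Longrightarrow> g p < g (p + h)"
      using DERIV_pos_inc_right[OF g(3,5)] by blast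
    obtain \<delta>2 where 2: "\<delta>2 > 0" "\<And>h. 0 < h \<Longrightarrow> h < \<delta>2 \<Longrightarrow> g (q - h) < g q"
      using DERIV_pos_inc_left[OF g(4,6)] by blast
    define h where "h = min (min \<delta>1 \<delta>2) (q - p) / 3"
    have "3 * h \<le> \<delta>1" "3 * h \<le> \<delta>2" "3 * h \<le> q - p" "h > 0"
      using 1(1) 2(1) pq by (auto simp: h_def)
    then have h: "h > 0" "h < \<delta>1" "h < \<delta>2" "p + h < q - h"
      using pq by linarith+
    have "g (p + h) > 0" "g (q - h) < 0" using 1(2)[of h] 2(2)[of h] h g(1,2) by auto
    then have "g (p + h) * g (q - h) < 0" by (rule mult_pos_neg)
    moreover have "isCont g x" if "p + h \<le> x" "x \<le> q - h" for x
      using that h by (intro g(7)) auto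
    ultimately obtain x where "x > p + h" "x < q - h" "g x = 0"
      using IVT_sign_change[OF h(4), of g] by blast
    then show ?thesis using h by (intro exI[of _ x]) auto
  qed
  show ?thesis
  proof (cases "d > 0")
    case True
    then have "e > 0" using de by (simp add: zero_less_mult_iff)
    then show ?thesis using main[OF f0 dp dq True _ cont] by blast
  next
    case False
    then have "- d > 0" "- e > 0" using de by (auto simp: zero_less_mult_iff)
    then have "\<exists>x>p. x < q \<and> - f x = 0"
      using dp dq cont f0 by (intro main[of "\<lambda>x. - f x" "- d" "- e"])
        (auto intro!: DERIV_minus continuous_minus)
    then show ?thesis by simp
  qed
qed

text \<open>At a zero of J_\<nu> both sides solve the same recurrence in k and agree at k = 0 and k
  = 1.\<close>

lemma Bessel_J_at_zero_order:
  assumes "\<nu> > - 1" "x > 0" "Bessel_J \<nu> x = 0"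
  shows "Bessel_J (\<nu> + real k) x = lom \<nu> k x * Bessel_J (\<nu> + 1) x"
proof -
  have "Bessel_J (\<nu> + real k) x = lom \<nu> k x * Bessel_J (\<nu> + 1) x
    \<and> Bessel_J (\<nu> + real (k + 1)) x = lom \<nu> (k + 1) x * Bessel_J (\<nu> + 1) x"
  proof (induction k)
    case 0
    then show ?case using assms lom_1[of \<nu> x] by (simp add: lom_0)
  next
    case (Suc k)
    have "Bessel_J (\<nu> + real (k + 2)) x = lom \<nu> (k + 2) x * Bessel_J (\<nu> + 1) x"
      unfolding lom_rec[OF assms(1,2)] Bessel_J_order_rec[OF assms(2)]
      using Suc by (simp add: algebra_simps)
    then show ?case using Suc by simp
  qed
  then show ?thesis ..
qed

theorem theorem3p1:
  fixes \<nu> :: real and m :: nat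
  assumes "\<nu> > - 1" and "m \<ge> 1"
    and "common_zeros m \<nu> = {}"
  shows "0 < bessel_zero \<nu> 1 \<and>
    (\<forall>k\<ge>1. bessel_zero \<nu> k < omega m \<nu> k \<and> omega m \<nu> k < bessel_zero \<nu> (k + 1))"
proof -
  define Z where "Z = {x. x > 0 \<and> Bessel_J \<nu> x = 0}"
  obtain j :: "nat \<Rightarrow> real" where j: "strict_mono j" "range j = Z"
    using locally_finite_enumeration[of Z] finite_bounded_Bessel_zeros[OF assms(1)]
      infinite_Bessel_zeros[of \<nu>] unfolding Z_def by blast
  have bz: "bessel_zero \<nu> k = j (k - 1)" for k
    unfolding bessel_zero_def Z_def[symmetric] by (rule kth_element_eq[OF j])
  have jZ: "j n > 0" "Bessel_J \<nu> (j n) = 0" for n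
  proof -
    have "j n \<in> Z" using j(2) by blast
    then show "j n > 0" "Bessel_J \<nu> (j n) = 0" by (auto simp: Z_def)
  qed
  have nzJ: "Bessel_J \<nu> x \<noteq> 0" if "0 < x" "x < j 0 \<or> j n < x \<and> x < j (Suc n)" for x n
  proof
    assume "Bessel_J \<nu> x = 0"
    then have "x \<in> range j" using that j(2) by (simp add: Z_def)
    then obtain i where "x = j i" by blast
    then show False using that j(1) by (auto simp: strict_mono_less)
  qed
  define P where "P = (\<lambda>x. lom \<nu> m x * Bessel_J (\<nu> + real m) x)"
  define S where "S = {x. x > 0 \<and> P x = 0}"
  define F where "F = (\<lambda>x. P x / Bessel_J \<nu> x)"
  have om: "omega m \<nu> = kth_element S"
  proof -
    have "{x. x > 0 \<and> Bessel_J (\<nu> + real m) x = 0} \<union> {x. x > 0 \<and> Lommel_R (m - 1) (\<nu> + 1) x = 0} = S"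
      using assms(2) by (auto simp: S_def P_def lom_def)
    then show ?thesis by (simp add: omega_def)
  qed
  \<comment> \<open>Absence of common zeros makes J_(\<nu>+m) nonzero at \<open>j n\<close>, hence
    both of its factors there; so \<open>P (j n)\<close> has the sign of J_(\<nu>+1).\<close>
  have Pj: "P (j n) = (lom \<nu> m (j n))\<^sup>2 * Bessel_J (\<nu> + 1) (j n)" "lom \<nu> m (j n) \<noteq> 0"
    "Bessel_J (\<nu> + 1) (j n) \<noteq> 0" "P (j n) \<noteq> 0" for n
  proof -
    have e: "Bessel_J (\<nu> + real m) (j n) = lom \<nu> m (j n) * Bessel_J (\<nu> + 1) (j n)"
      by (rule Bessel_J_at_zero_order[OF assms(1) jZ])
    have "Bessel_J (\<nu> + real m) (bessel_zero \<nu> (n + 1)) \<noteq> 0"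
      using assms(3) unfolding common_zeros_def by fastforce
    then have nz: "Bessel_J (\<nu> + real m) (j n) \<noteq> 0" by (simp add: bz)
    show "P (j n) = (lom \<nu> m (j n))\<^sup>2 * Bessel_J (\<nu> + 1) (j n)"
      unfolding P_def e by (simp add: power2_eq_square)
    show "lom \<nu> m (j n) \<noteq> 0" "Bessel_J (\<nu> + 1) (j n) \<noteq> 0" using nz e by auto
    then show "P (j n) \<noteq> 0" unfolding P_def e by simp
  qed
  have F_less: "F p < F q" if "0 < p" "p < q" "\<And>x. p \<le> x \<Longrightarrow> x \<le> q \<Longrightarrow> Bessel_J \<nu> x \<noteq> 0" for p q
    using that(2)
  proof (rule DERIV_pos_imp_increasing)
    fix x assume "p \<le> x" "x \<le> q"
    then show "\<exists>y. (F has_field_derivative y) (at x) \<and> y > 0"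
      using green_deriv_pos[OF assms(1) _ assms(2), of x] that(1) that(3)[of x]
      unfolding F_def P_def by auto
  qed
  have Pcont: "isCont P x" if "x > 0" for x
    unfolding P_def
    by (intro continuous_mult DERIV_isCont[OF lom_deriv] isCont_Bessel_J that)
  have ex1: "\<exists>!s. s \<in> S \<and> j n < s \<and> s < j (Suc n)" for n
  proof -
    have jn: "j n < j (Suc n)" using j(1) by (simp add: strict_mono_Suc_iff)
    \<comment> \<open>The slopes of J_\<nu> at consecutive zeros cannot agree in sign, as that would
      force a zero between them.\<close>
    have slope: "\<not> (- Bessel_J (\<nu> + 1) (j n)) * (- Bessel_J (\<nu> + 1) (j (Suc n))) > 0"
    proof
      assume "(- Bessel_J (\<nu> + 1) (j n)) * (- Bessel_J (\<nu> + 1) (j (Suc n))) > 0"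
      then have "\<exists>x>j n. x < j (Suc n) \<and> Bessel_J \<nu> x = 0"
        by (rule zero_between_same_slope[OF jn jZ(2) jZ(2) Bessel_J_deriv_at_zero[OF jZ]
              Bessel_J_deriv_at_zero[OF jZ]])
          (use jZ(1)[of n] in \<open>auto intro!: isCont_Bessel_J\<close>)
      then obtain x where "x > j n" "x < j (Suc n)" "Bessel_J \<nu> x = 0" by blast
      then show False using nzJ[of x n] jZ(1)[of n] by simp
    qed
    then have "Bessel_J (\<nu> + 1) (j n) * Bessel_J (\<nu> + 1) (j (Suc n)) < 0"
      using Pj(3)[of n] Pj(3)[of "Suc n"] by (simp add: linorder_not_less order_le_less)
    moreover have "(lom \<nu> m (j n))\<^sup>2 * (lom \<nu> m (j (Suc n)))\<^sup>2 > 0"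
      using Pj(2)[of n] Pj(2)[of "Suc n"] by simp
    ultimately have "((lom \<nu> m (j n))\<^sup>2 * (lom \<nu> m (j (Suc n)))\<^sup>2)
      * (Bessel_J (\<nu> + 1) (j n) * Bessel_J (\<nu> + 1) (j (Suc n))) < 0" by (rule mult_pos_neg[rotated])
    then have "P (j n) * P (j (Suc n)) < 0" unfolding Pj(1) by (simp add: mult_ac)
    moreover have "isCont P x" if "j n \<le> x" for x
      using jZ(1)[of n] that by (intro Pcont) simp
    ultimately obtain s where s: "s > j n" "s < j (Suc n)" "P s = 0"
      using IVT_sign_change[OF jn, of P] by blast
    \<comment> \<open>Two zeros of \<open>P\<close> in one gap would be two zeros of the strictly
      increasing \<open>F\<close>.\<close>
    have less: False if "p \<in> S" "q \<in> S" "j n < p" "p < q" "q < j (Suc n)" for p q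
    proof -
      have "F p < F q"
        using that jZ(1)[of n] by (intro F_less nzJ[of _ n]) auto
      moreover have "F p = 0" "F q = 0" using that by (auto simp: S_def F_def)
      ultimately show False by simp
    qed
    show ?thesis
    proof (rule ex1I[of _ s])
      show "s \<in> S \<and> j n < s \<and> s < j (Suc n)" using s jZ(1)[of n] by (simp add: S_def)
      fix t assume "t \<in> S \<and> j n < t \<and> t < j (Suc n)"
      then show "t = s" using less[of t s] less[of s t] s jZ(1)[of n]
        by (cases t s rule: linorder_cases) (auto simp: S_def)
    qed
  qed
  have low: "j 0 \<le> s" if s: "s \<in> S" for s
  proof (rule ccontr)
    assume "\<not> j 0 \<le> s"
    then have s0: "s < j 0" "s > 0" using s by (auto simp: S_def)
    have "\<nu> + real m > - 1" using assms by simp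
    then have "\<forall>\<^sub>F x in at_right 0. Bessel_J (\<nu> + real m) x > 0" by (rule Bessel_J_pos_near_0)
    moreover have "\<forall>\<^sub>F x in at_right 0. Bessel_J \<nu> x > 0" using assms(1) by (rule Bessel_J_pos_near_0)
    \<comment> \<open>The bound \<nu> + 1 is what \<open>lom_pos\<close> requires; the bound s
      places x before the supposed zero, where \<open>F\<close> must be smaller than F s =
      0.\<close>
    moreover have "\<forall>\<^sub>F x in at_right 0. x \<in> {0<..<min s (\<nu> + 1)}"
      using s0 assms(1) by (intro eventually_at_right_real) auto
    ultimately have "\<forall>\<^sub>F x in at_right 0. x > 0 \<and> x < s \<and> F x > 0"
    proof eventually_elim
      case (elim x)
      then have "lom \<nu> m x > 0" using lom_pos[of \<nu> x "m - 1"] assms by simp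
      then show ?case using elim by (simp add: F_def P_def)
    qed
    then obtain x where x: "x > 0" "x < s" "F x > 0"
      using eventually_happens'[of "at_right (0::real)"] trivial_limit_at_right_real[of 0] by blast
    have "F x < F s" using x s0 by (intro F_less nzJ) auto
    moreover have "F s = 0" using s by (simp add: S_def F_def)
    ultimately show False using x by simp
  qed
  have disj: "S \<inter> range j = {}" using Pj(4) by (auto simp: S_def)
  have unb: "\<exists>n. j n > M" for M
  proof (rule ccontr)
    assume "\<not> ?thesis"
    then have "Z \<subseteq> Z \<inter> {..M}" using j(2) by (auto simp: not_less)
    then have "finite Z" using finite_bounded_Bessel_zeros[OF assms(1), of M] finite_subset
      unfolding Z_def by blast
    then show False using infinite_Bessel_zeros by (simp add: Z_def)
  qed
  have "j (k - 1) < kth_element S k \<and> kth_element S k < j k" if "k \<ge> 1" for k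
    by (rule kth_element_interlacing[OF j(1) unb ex1 disj low that])
  then show ?thesis using jZ(1)[of 0] by (simp add: bz om)
qed

end
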